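(* Let $A\in\mathbb{C}^{n\times n}$ be a positive definite matrix, $B\in\mathbb{C}^{n\times n}$ a positive semidefinite matrix, at least one of $A$, $B$ being non-Hermitian, and let $C\in\mathbb{C}^{n\times n}$. Then for any $\hat\alpha>0$ and $\hat\omega\in[0,2)$, and every initial guess $X^{(0)}\in\mathbb{C}^{n\times n}$, the sequence $(X^{(k)})_{k\ge0}$ defined by $$\begin{cases}(\hat\alpha I+A)X^{(k+\frac12)}=X^{(k)}(\hat\alpha I-B)+C,\\ X^{(k+1)}(\hat\alpha I+B)=X^{(k)}(B-(1-\hat\omega)\hat\alpha I)+(2-\hat\omega)\hat\alpha X^{(k+\frac12)},\end{cases}\qquad k=0,1,2,\ldots$$ converges to the unique solution $X^*$ of the continuous Sylvester equation $AX+XB=C$.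
   Context: $I$ denotes the identity matrix. Positive (semi-)definite matrices are not required to be Hermitian: $X\in\mathbb{C}^{n\times n}$ is positive definite (resp. positive semidefinite) if its Hermitian part $\frac12(X+X^* )$ is Hermitian positive definite (resp. Hermitian positive semidefinite), where $X^*$ is the conjugate transpose. *)

theory Defs
  imports "HOL-Analysis.Analysis" "HOL-Library.Complex_Order"
begin

definition conj_transpose :: "complex^'n^'m \<Rightarrow> complex^'m^'n" where
  "conj_transpose X = map_matrix cnj (transpose X)"

definition hermitian :: "complex^'n^'n \<Rightarrow> bool" where
  "hermitian X \<longleftrightarrow> conj_transpose X = X"

(* The scalar x^* X x. *)
definition quadratic_form :: "complex^'n^'n \<Rightarrow> complex^'n \<Rightarrow> complex" where
  "quadratic_form X x = (\<Sum>i\<in>UNIV. cnj (x $ i) * (X *v x) $ i)"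

(* In the next two definitions the order is that of Complex_Order:
   0 < z means that z is real and positive, and similarly for \<le>. *)
definition hermitian_pos_def :: "complex^'n^'n \<Rightarrow> bool" where
  "hermitian_pos_def X \<longleftrightarrow> hermitian X \<and> (\<forall>x. x \<noteq> 0 \<longrightarrow> 0 < quadratic_form X x)"

definition hermitian_pos_semidef :: "complex^'n^'n \<Rightarrow> bool" where
  "hermitian_pos_semidef X \<longleftrightarrow> hermitian X \<and> (\<forall>x. 0 \<le> quadratic_form X x)"

definition hermitian_part :: "complex^'n^'n \<Rightarrow> complex^'n^'n" where
  "hermitian_part X = (1/2) *\<^sub>R (X + conj_transpose X)"

(* These two notions do not require X itself to be Hermitian. *)
definition pos_def :: "complex^'n^'n \<Rightarrow> bool" where
  "pos_def X \<longleftrightarrow> hermitian_pos_def (hermitian_part X)"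

definition pos_semidef :: "complex^'n^'n \<Rightarrow> bool" where
  "pos_semidef X \<longleftrightarrow> hermitian_pos_semidef (hermitian_part X)"

(* X k is the k-th iterate and Y k is the intermediate iterate with index k + 1/2. *)
definition sylvester_iteration ::
  "complex^'n^'n \<Rightarrow> complex^'n^'n \<Rightarrow> complex^'n^'n \<Rightarrow> real \<Rightarrow> real \<Rightarrow>
   (nat \<Rightarrow> complex^'n^'n) \<Rightarrow> (nat \<Rightarrow> complex^'n^'n) \<Rightarrow> bool" where
  "sylvester_iteration A B C \<alpha> \<omega> X Y \<longleftrightarrow>
     (\<forall>k. (\<alpha> *\<^sub>R mat 1 + A) ** Y k = X k ** (\<alpha> *\<^sub>R mat 1 - B) + C \<and>
          X (Suc k) ** (\<alpha> *\<^sub>R mat 1 + B) =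
            X k ** (B - ((1 - \<omega>) * \<alpha>) *\<^sub>R mat 1) + ((2 - \<omega>) * \<alpha>) *\<^sub>R Y k)"

end

theory Submission
  imports Defs
begin

text \<open>
  Write \<open>f Y = A ** Y\<close> and \<open>g Y = Y ** B\<close>. The norm of \<open>complex^'n^'n\<close> is the Frobenius norm, which
  comes from the real inner product \<open>Re (trace (X\<^sup>* Y))\<close>. For this inner product \<open>f\<close> is strictly
  positive and \<open>g\<close> is nonnegative, because \<open>inner Y (f Y)\<close> and \<open>inner Y (g Y)\<close> are sums of values of
  the real parts of the quadratic forms of \<open>A\<close> and \<open>B\<close>, at the columns of \<open>Y\<close> and at the conjugated
  rows of \<open>Y\<close> respectively. The rest is about two linear operators on a Euclidean space.

  A strictly positive operator on a finite-dimensional space is injective, hence bijective. Applied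
  to \<open>f + g\<close> this makes the Sylvester equation uniquely solvable; applied to \<open>\<alpha> + f\<close> and \<open>\<alpha> + g\<close> it
  makes every step of the iteration solvable, so that the iteration is determined by its start.

  For convergence, subtract the solution, which leaves the homogeneous iteration for the errors \<open>e k\<close>
  and the half-step errors \<open>h k\<close>. With \<open>\<theta> = \<omega> / 2\<close> one has
  \<open>g - (1 - \<omega>) \<alpha> = \<theta> (\<alpha> + g) - (1 - \<theta>) (\<alpha> - g)\<close>, and the first half step replaces \<open>(\<alpha> - g) (e k)\<close>
  by \<open>(\<alpha> + f) (h k)\<close>. So the residuals \<open>d k = (\<alpha> + g) (e k)\<close> satisfy
  \<open>d (k + 1) = \<theta> d k + (1 - \<theta>) (\<alpha> - f) (h k)\<close>. Since \<open>f\<close> is strictly positive there is \<open>q < 1\<close> with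
  \<open>\<parallel>(\<alpha> - f) (h k)\<parallel> \<le> q \<parallel>(\<alpha> + f) (h k)\<parallel> = q \<parallel>(\<alpha> - g) (e k)\<parallel> \<le> q \<parallel>d k\<parallel>\<close> (lemma
  \<open>cayley_strict_contraction\<close>; its weak form for \<open>g\<close> is \<open>cayley_contraction\<close>). Hence \<open>\<parallel>d k\<parallel>\<close>
  decays geometrically, with ratio \<open>\<theta> + (1 - \<theta>) q < 1\<close>, and \<open>\<alpha> \<parallel>e k\<parallel> \<le> \<parallel>d k\<parallel>\<close>.
\<close>

section \<open>Positive operators on a Euclidean space\<close>

lemma strictly_positive_imp_bij:
  fixes f :: "'a::euclidean_space \<Rightarrow> 'a"
  assumes "linear f" and "\<And>x. x \<noteq> 0 \<Longrightarrow> 0 < inner x (f x)"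
  shows "bij f"
proof -
  have "inj f"
    using assms by (metis inner_zero_right less_irrefl linear_injective_0)
  then show ?thesis
    using assms(1) linear_injective_imp_surjective by (auto simp: bij_def)
qed

lemma bij_shifted_nonneg:
  fixes f :: "'a::euclidean_space \<Rightarrow> 'a"
  assumes "linear f" and "\<And>x. 0 \<le> inner x (f x)" and "\<alpha> > 0"
  shows "bij (\<lambda>x. \<alpha> *\<^sub>R x + f x)"
proof (rule strictly_positive_imp_bij)
  show "linear (\<lambda>x. \<alpha> *\<^sub>R x + f x)"
    by (intro linear_compose_add linear_compose_scale_right linear_ident assms(1))
  show "0 < inner x (\<alpha> *\<^sub>R x + f x)" if "x \<noteq> 0" for x
    using that assms(2)[of x] assms(3) by (simp add: inner_add_right add_pos_nonneg)
qed

text \<open>Compactness of the unit sphere turns strict positivity into a uniform lower bound.\<close>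

lemma strictly_positive_coercive:
  fixes f :: "'a::euclidean_space \<Rightarrow> 'a"
  assumes "linear f" and "\<And>x. x \<noteq> 0 \<Longrightarrow> 0 < inner x (f x)"
  obtains m where "m > 0" and "\<And>x. m * (norm x)\<^sup>2 \<le> inner x (f x)"
proof -
  have cont: "continuous_on (sphere 0 1) (\<lambda>x. inner x (f x))"
    using assms(1)
    by (simp add: continuous_on_inner linear_continuous_on linear_conv_bounded_linear)
  have "sphere (0::'a) 1 \<noteq> {}" by simp
  then obtain y where y: "y \<in> sphere 0 1"
    and min: "\<And>x. x \<in> sphere 0 1 \<Longrightarrow> inner y (f y) \<le> inner x (f x)"
    using continuous_attains_inf[OF compact_sphere _ cont] by blast
  show ?thesis
  proof
    have "y \<noteq> 0" using y by auto
    then show "0 < inner y (f y)" by (rule assms(2))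
    show "inner y (f y) * (norm x)\<^sup>2 \<le> inner x (f x)" for x
    proof (cases "x = 0")
      case False
      have "inner y (f y) \<le> inner (x /\<^sub>R norm x) (f (x /\<^sub>R norm x))"
        using False by (intro min) simp
      also have "\<dots> = inner x (f x) / (norm x)\<^sup>2"
        by (simp add: linear_cmul[OF assms(1)] power2_eq_square divide_inverse_commute mult.assoc)
      finally show ?thesis using False by (simp add: field_simps)
    qed (use assms(1) in \<open>simp add: linear_0\<close>)
  qed
qed

lemma norm_shift_diff:
  fixes x y :: "'a::real_inner"
  shows "(norm (\<alpha> *\<^sub>R x - y))\<^sup>2 = (norm (\<alpha> *\<^sub>R x + y))\<^sup>2 - 4 * \<alpha> * inner x y"
  by (simp add: power2_norm_eq_inner inner_simps inner_commute algebra_simps)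

text \<open>The Cayley transform \<open>(\<alpha> - g) (\<alpha> + g)\<inverse>\<close> of a nonnegative operator is a contraction; the bound
  is stated without the inverse.\<close>

lemma cayley_contraction:
  fixes g :: "'a::real_inner \<Rightarrow> 'a"
  assumes "0 \<le> inner x (g x)" and "\<alpha> > 0"
  shows "norm (\<alpha> *\<^sub>R x - g x) \<le> norm (\<alpha> *\<^sub>R x + g x)"
proof (rule power2_le_imp_le)
  show "(norm (\<alpha> *\<^sub>R x - g x))\<^sup>2 \<le> (norm (\<alpha> *\<^sub>R x + g x))\<^sup>2"
    using assms by (simp add: norm_shift_diff)
qed simp

text \<open>By \<open>norm_shift_diff\<close> the gap between the two squared norms is \<open>4 * \<alpha> * inner x (f x)\<close>, which
  coercivity of \<open>f\<close> and boundedness of \<open>\<alpha> + f\<close> bound below by a multiple of the larger one.\<close>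

lemma cayley_strict_contraction:
  fixes f :: "'a::euclidean_space \<Rightarrow> 'a"
  assumes "linear f" and "\<And>x. x \<noteq> 0 \<Longrightarrow> 0 < inner x (f x)" and "\<alpha> > 0"
  obtains q where "0 \<le> q" and "q < 1"
    and "\<And>x. norm (\<alpha> *\<^sub>R x - f x) \<le> q * norm (\<alpha> *\<^sub>R x + f x)"
proof -
  obtain m where m: "m > 0" "\<And>x. m * (norm x)\<^sup>2 \<le> inner x (f x)"
    using strictly_positive_coercive[OF assms(1,2)] by blast
  have "linear (\<lambda>x. \<alpha> *\<^sub>R x + f x)"
    by (intro linear_compose_add linear_compose_scale_right linear_ident assms(1))
  then obtain c where c: "c > 0" "\<And>x. norm (\<alpha> *\<^sub>R x + f x) \<le> c * norm x"
    using linear_bounded_pos by blast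
  define r where "r = 1 - 4 * \<alpha> * m / c\<^sup>2"
  have r: "(norm (\<alpha> *\<^sub>R x - f x))\<^sup>2 \<le> r * (norm (\<alpha> *\<^sub>R x + f x))\<^sup>2" for x
  proof -
    have "(norm (\<alpha> *\<^sub>R x + f x))\<^sup>2 \<le> (c * norm x)\<^sup>2"
      using c(2) by (intro power_mono) auto
    then have "m / c\<^sup>2 * (norm (\<alpha> *\<^sub>R x + f x))\<^sup>2 \<le> m / c\<^sup>2 * (c * norm x)\<^sup>2"
      using m(1) by (intro mult_left_mono) auto
    also have "\<dots> = m * (norm x)\<^sup>2"
      using c(1) by (simp add: power_mult_distrib)
    also have "\<dots> \<le> inner x (f x)" by (rule m(2))
    finally have "4 * \<alpha> * (m / c\<^sup>2 * (norm (\<alpha> *\<^sub>R x + f x))\<^sup>2) \<le> 4 * \<alpha> * inner x (f x)"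
      using assms(3) by (intro mult_left_mono) auto
    then show ?thesis by (simp add: norm_shift_diff r_def algebra_simps)
  qed
  show ?thesis
  proof
    \<comment> \<open>In fact \<open>r \<ge> 0\<close>, because the space contains a nonzero vector; the maximum saves that argument.\<close>
    show "0 \<le> sqrt (max 0 r)" by simp
    have "r < 1" using m(1) c(1) assms(3) by (simp add: r_def)
    then show "sqrt (max 0 r) < 1" by (simp add: real_sqrt_lt_1_iff)
    show "norm (\<alpha> *\<^sub>R x - f x) \<le> sqrt (max 0 r) * norm (\<alpha> *\<^sub>R x + f x)" for x
    proof (rule power2_le_imp_le)
      have "r * (norm (\<alpha> *\<^sub>R x + f x))\<^sup>2 \<le> max 0 r * (norm (\<alpha> *\<^sub>R x + f x))\<^sup>2"
        by (intro mult_right_mono) auto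
      with r[of x] show "(norm (\<alpha> *\<^sub>R x - f x))\<^sup>2 \<le> (sqrt (max 0 r) * norm (\<alpha> *\<^sub>R x + f x))\<^sup>2"
        by (simp add: power_mult_distrib)
    qed simp
  qed
qed

section \<open>The two-step iteration for a pair of operators\<close>

lemma implicit_two_step_recursion_unique:
  fixes P :: "'b \<Rightarrow> 'c" and Q :: "'a \<Rightarrow> 'd"
  assumes "bij P" and "bij Q"
  shows "\<exists>!p. fst p 0 = x0 \<and>
    (\<forall>k. P (snd p k) = F (fst p k) \<and> Q (fst p (Suc k)) = G (fst p k) (snd p k))"
proof -
  define N where "N x = inv Q (G x (inv P (F x)))" for x
  define X where "X k = (N ^^ k) x0" for k
  define Y where "Y k = inv P (F (X k))" for k
  have P: "P y = z \<longleftrightarrow> y = inv P z" for y z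
    using assms(1) by (metis bij_inv_eq_iff)
  have Q: "Q y = z \<longleftrightarrow> y = inv Q z" for y z
    using assms(2) by (metis bij_inv_eq_iff)
  show ?thesis
  proof (rule ex1I[of _ "(X, Y)"])
    show "fst (X, Y) 0 = x0 \<and> (\<forall>k. P (snd (X, Y) k) = F (fst (X, Y) k) \<and>
      Q (fst (X, Y) (Suc k)) = G (fst (X, Y) k) (snd (X, Y) k))"
      unfolding P Q by (simp add: X_def Y_def N_def)
  next
    fix p
    assume p: "fst p 0 = x0 \<and>
      (\<forall>k. P (snd p k) = F (fst p k) \<and> Q (fst p (Suc k)) = G (fst p k) (snd p k))"
    have X: "fst p k = X k" for k
    proof (induction k)
      case 0
      show ?case using p by (simp add: X_def)
    next
      case (Suc k)
      then show ?case using p unfolding P Q by (simp add: X_def N_def)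
    qed
    moreover have "snd p k = Y k" for k
      using p X unfolding P by (simp add: Y_def)
    ultimately show "p = (X, Y)" by (simp add: prod_eq_iff fun_eq_iff)
  qed
qed

text \<open>The bound is on \<open>(\<alpha> + g) (e k)\<close> and not on \<open>e k\<close> itself, since in these terms the two
  half steps combine without commuting \<open>f\<close> with \<open>g\<close>.\<close>

lemma two_step_error_tendsto_0:
  fixes f g :: "'a::euclidean_space \<Rightarrow> 'a" and e h :: "nat \<Rightarrow> 'a"
  assumes "linear f" and "\<And>x. x \<noteq> 0 \<Longrightarrow> 0 < inner x (f x)" and g: "\<And>x. 0 \<le> inner x (g x)"
    and "\<alpha> > 0" and "0 \<le> \<omega>" and "\<omega> < 2"
    and half: "\<And>k. \<alpha> *\<^sub>R h k + f (h k) = \<alpha> *\<^sub>R e k - g (e k)"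
    and full: "\<And>k. \<alpha> *\<^sub>R e (Suc k) + g (e (Suc k)) =
      g (e k) - ((1 - \<omega>) * \<alpha>) *\<^sub>R e k + ((2 - \<omega>) * \<alpha>) *\<^sub>R h k"
  shows "e \<longlonglongrightarrow> 0"
proof -
  obtain q where q: "0 \<le> q" "q < 1"
    and qf: "\<And>x. norm (\<alpha> *\<^sub>R x - f x) \<le> q * norm (\<alpha> *\<^sub>R x + f x)"
    using cayley_strict_contraction[OF assms(1,2,4)] by blast
  define \<theta> where "\<theta> = \<omega> / 2"
  have \<theta>: "0 \<le> \<theta>" "\<theta> < 1" using assms(5,6) by (auto simp: \<theta>_def)
  define d where "d k = \<alpha> *\<^sub>R e k + g (e k)" for k
  define \<rho> where "\<rho> = \<theta> + (1 - \<theta>) * q"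
  have \<rho>: "0 \<le> \<rho>" "\<rho> < 1"
  proof -
    show "0 \<le> \<rho>" using \<theta> q by (simp add: \<rho>_def)
    have "(1 - \<theta>) * q < (1 - \<theta>) * 1" using \<theta> q by (intro mult_strict_left_mono) auto
    then show "\<rho> < 1" by (simp add: \<rho>_def)
  qed
  have step: "norm (d (Suc k)) \<le> \<rho> * norm (d k)" for k
  proof -
    have "\<alpha> *\<^sub>R h k - f (h k) = (2 * \<alpha>) *\<^sub>R h k - \<alpha> *\<^sub>R e k + g (e k)"
      using half[of k] unfolding mult_2 scaleR_add_left by (simp add: algebra_simps)
    moreover have "((1 - \<omega>) * \<alpha>) *\<^sub>R e k = (1 - \<theta>) *\<^sub>R \<alpha> *\<^sub>R e k - \<theta> *\<^sub>R \<alpha> *\<^sub>R e k"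
    proof -
      have "(1 - \<omega>) * \<alpha> = (1 - \<theta>) * \<alpha> - \<theta> * \<alpha>" by (simp add: \<theta>_def field_simps)
      then show ?thesis by (simp only: scaleR_scaleR scaleR_diff_left)
    qed
    moreover have "((2 - \<omega>) * \<alpha>) *\<^sub>R h k = (1 - \<theta>) *\<^sub>R (2 * \<alpha>) *\<^sub>R h k"
    proof -
      have "(2 - \<omega>) * \<alpha> = (1 - \<theta>) * (2 * \<alpha>)" by (simp add: \<theta>_def field_simps)
      then show ?thesis by (simp only: scaleR_scaleR)
    qed
    ultimately have "d (Suc k) = \<theta> *\<^sub>R d k + (1 - \<theta>) *\<^sub>R (\<alpha> *\<^sub>R h k - f (h k))"
      unfolding d_def full by (simp only:) (simp add: algebra_simps)
    then have "norm (d (Suc k)) \<le> \<theta> * norm (d k) + (1 - \<theta>) * norm (\<alpha> *\<^sub>R h k - f (h k))"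
      using \<theta> by (metis norm_triangle_ineq norm_scaleR abs_of_nonneg diff_ge_0_iff_ge less_imp_le)
    also have "\<dots> \<le> \<theta> * norm (d k) + (1 - \<theta>) * (q * norm (d k))"
    proof -
      have "norm (\<alpha> *\<^sub>R h k - f (h k)) \<le> q * norm (\<alpha> *\<^sub>R e k - g (e k))"
        using qf[of "h k"] by (simp add: half)
      also have "\<dots> \<le> q * norm (d k)"
        unfolding d_def using q(1) g assms(4) by (intro mult_left_mono cayley_contraction)
      finally show ?thesis using \<theta> by (intro add_left_mono mult_left_mono) auto
    qed
    also have "\<dots> = \<rho> * norm (d k)" by (simp add: \<rho>_def algebra_simps)
    finally show ?thesis .
  qed
  have d: "norm (d k) \<le> norm (d 0) * \<rho> ^ k" for k
  proof (induction k)
    case (Suc k)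
    have "norm (d (Suc k)) \<le> \<rho> * (norm (d 0) * \<rho> ^ k)"
      using step[of k] mult_left_mono[OF Suc \<rho>(1)] by linarith
    then show ?case by (simp add: algebra_simps)
  qed simp
  have bound: "norm (e k) \<le> norm (d 0) / \<alpha> * \<rho> ^ k" for k
  proof -
    have "\<alpha> * (norm (e k))\<^sup>2 \<le> inner (e k) (d k)"
      using g[of "e k"] by (simp add: d_def inner_add_right power2_norm_eq_inner)
    also have "\<dots> \<le> norm (e k) * norm (d k)" by (rule norm_cauchy_schwarz)
    finally have "\<alpha> * norm (e k) \<le> norm (d k)"
      by (cases "e k = 0") (simp_all add: power2_eq_square)
    then show ?thesis using d[of k] assms(4) by (simp add: field_simps)
  qed
  have "(\<lambda>k. norm (d 0) / \<alpha> * \<rho> ^ k) \<longlonglongrightarrow> 0"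
    using \<rho> by (intro tendsto_mult_right_zero LIMSEQ_realpow_zero)
  with bound show ?thesis
    by (rule Lim_null_comparison[OF always_eventually[OF allI]])
qed

section \<open>Positive definite matrices acting on matrices\<close>

lemma Re_quadratic_form_hermitian_part:
  "Re (quadratic_form (hermitian_part X) x) = Re (quadratic_form X x)"
proof -
  have adj: "quadratic_form (conj_transpose X) x = cnj (quadratic_form X x)"
  proof -
    have "quadratic_form (conj_transpose X) x = (\<Sum>i\<in>UNIV. \<Sum>j\<in>UNIV. cnj (x $ i) * (cnj (X $ j $ i) * x $ j))"
      by (simp add: quadratic_form_def conj_transpose_def matrix_vector_mult_def transpose_def
          map_matrix_def sum_distrib_left)
    also have "\<dots> = (\<Sum>j\<in>UNIV. \<Sum>i\<in>UNIV. cnj (x $ i) * (cnj (X $ j $ i) * x $ j))"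
      by (rule sum.swap)
    also have "\<dots> = cnj (quadratic_form X x)"
      by (simp add: quadratic_form_def matrix_vector_mult_def sum_distrib_left mult_ac)
    finally show ?thesis .
  qed
  have "quadratic_form (hermitian_part X) x =
    (1/2) *\<^sub>R (quadratic_form X x + quadratic_form (conj_transpose X) x)"
    by (simp add: quadratic_form_def hermitian_part_def matrix_vector_mult_def scaleR_sum_right
        sum_distrib_left sum.distrib algebra_simps)
  then show ?thesis by (simp add: adj)
qed

lemma pos_def_Re_quadratic_form: "pos_def X \<Longrightarrow> x \<noteq> 0 \<Longrightarrow> 0 < Re (quadratic_form X x)"
  by (metis Re_quadratic_form_hermitian_part hermitian_pos_def_def less_complex_def pos_def_def
      zero_complex.simps(1))

lemma pos_semidef_Re_quadratic_form: "pos_semidef X \<Longrightarrow> 0 \<le> Re (quadratic_form X x)"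
  by (metis Re_quadratic_form_hermitian_part hermitian_pos_semidef_def less_eq_complex_def
      pos_semidef_def zero_complex.simps(1))

lemma inner_complex_eq_Re: "inner (x::complex) y = Re (cnj x * y)"
  by (simp add: inner_complex_def)

lemma inner_matrix_mult_left:
  fixes A Y :: "complex^'n^'n"
  shows "inner Y (A ** Y) = (\<Sum>j\<in>UNIV. Re (quadratic_form A (column j Y)))"
proof -
  have "inner Y (A ** Y) = (\<Sum>i\<in>UNIV. \<Sum>j\<in>UNIV. Re (cnj (Y $ i $ j) * (A ** Y) $ i $ j))"
    by (simp only: inner_vec_def inner_complex_eq_Re)
  also have "\<dots> = (\<Sum>j\<in>UNIV. \<Sum>i\<in>UNIV. Re (cnj (Y $ i $ j) * (A ** Y) $ i $ j))"
    by (rule sum.swap)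
  finally show ?thesis
    by (simp only: quadratic_form_def column_def matrix_vector_mult_def matrix_matrix_mult_def
        vec_lambda_beta Re_sum)
qed

text \<open>Multiplication on the right acts on rows, and there the quadratic form sees the row conjugated.\<close>

lemma inner_matrix_mult_right:
  fixes B Y :: "complex^'n^'n"
  shows "inner Y (Y ** B) = (\<Sum>i\<in>UNIV. Re (quadratic_form B (\<chi> j. cnj (Y $ i $ j))))"
proof -
  have "(\<Sum>j\<in>UNIV. cnj (Y $ i $ j) * (Y ** B) $ i $ j) = quadratic_form B (\<chi> j. cnj (Y $ i $ j))"
    for i
  proof -
    have "(\<Sum>j\<in>UNIV. cnj (Y $ i $ j) * (Y ** B) $ i $ j)
        = (\<Sum>j\<in>UNIV. \<Sum>k\<in>UNIV. cnj (Y $ i $ j) * (Y $ i $ k * B $ k $ j))"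
      by (simp add: matrix_matrix_mult_def sum_distrib_left)
    also have "\<dots> = (\<Sum>k\<in>UNIV. \<Sum>j\<in>UNIV. cnj (Y $ i $ j) * (Y $ i $ k * B $ k $ j))"
      by (rule sum.swap)
    also have "\<dots> = quadratic_form B (\<chi> j. cnj (Y $ i $ j))"
      by (simp add: quadratic_form_def matrix_vector_mult_def sum_distrib_left mult_ac)
    finally show ?thesis .
  qed
  then show ?thesis
    by (simp only: inner_vec_def inner_complex_eq_Re flip: Re_sum)
qed

lemma pos_def_mult_left_strictly_positive:
  fixes A Y :: "complex^'n^'n"
  assumes "pos_def A" and "Y \<noteq> 0"
  shows "0 < inner Y (A ** Y)"
proof -
  obtain j where "column j Y \<noteq> 0"
    using assms(2) by (auto simp: vec_eq_iff column_def)
  moreover have "0 \<le> Re (quadratic_form A (column j Y))" for j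
    using pos_def_Re_quadratic_form[OF assms(1)]
    by (cases "column j Y = 0") (auto simp: quadratic_form_def less_imp_le)
  ultimately show ?thesis
    unfolding inner_matrix_mult_left
    using pos_def_Re_quadratic_form[OF assms(1)] by (intro sum_pos2[of _ j]) auto
qed

lemma pos_semidef_mult_right_nonneg:
  fixes B Y :: "complex^'n^'n"
  shows "pos_semidef B \<Longrightarrow> 0 \<le> inner Y (Y ** B)"
  unfolding inner_matrix_mult_right by (intro sum_nonneg pos_semidef_Re_quadratic_form)

lemma matrix_mult_add_right: "(X + Y) ** Z = X ** Z + Y ** (Z::complex^'p^'n)"
  by (simp add: vec_eq_iff matrix_matrix_mult_def sum.distrib distrib_right)

lemma matrix_mult_scaleR_right: "X ** (c *\<^sub>R Y) = c *\<^sub>R (X ** (Y::complex^'p^'n))"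
  by (simp only: matrix_scalar_ac scalar_matrix_assoc)

lemma linear_matrix_mult_left: "linear (\<lambda>Y. (A::complex^'n^'n) ** Y)"
  by (intro linearI matrix_add_ldistrib matrix_mult_scaleR_right)

lemma linear_matrix_mult_right: "linear (\<lambda>Y. Y ** (B::complex^'n^'n))"
  by (intro linearI matrix_mult_add_right scalar_matrix_assoc[symmetric])

lemmas matrix_mult_diff_left = linear_diff[OF linear_matrix_mult_left]
lemmas matrix_mult_diff_right = linear_diff[OF linear_matrix_mult_right]

section \<open>Convergence to the solution of the Sylvester equation\<close>

lemma sylvester_iteration_alt:
  fixes A B C :: "complex^'n^'n"
  shows "sylvester_iteration A B C \<alpha> \<omega> X Y \<longleftrightarrow>
    (\<forall>k. \<alpha> *\<^sub>R Y k + A ** Y k = \<alpha> *\<^sub>R X k - X k ** B + C \<and>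
         \<alpha> *\<^sub>R X (Suc k) + X (Suc k) ** B =
           X k ** B - ((1 - \<omega>) * \<alpha>) *\<^sub>R X k + ((2 - \<omega>) * \<alpha>) *\<^sub>R Y k)"
proof -
  have l: "(c *\<^sub>R mat 1) ** Z = c *\<^sub>R Z" and r: "Z ** (c *\<^sub>R mat 1) = c *\<^sub>R Z"
    for c :: real and Z :: "complex^'n^'n"
    by (simp_all add: matrix_mult_scaleR_right flip: scalar_matrix_assoc)
  show ?thesis
    by (simp add: sylvester_iteration_def matrix_add_ldistrib matrix_mult_add_right l r
        matrix_mult_diff_left matrix_mult_diff_right)
qed

theorem theorem2p11:
  fixes A B C :: "complex^'n^'n" and \<alpha> \<omega> :: real
  assumes "pos_def A" and "pos_semidef B"
    and "\<not> hermitian A \<or> \<not> hermitian B"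
    and "\<alpha> > 0" and "0 \<le> \<omega>" and "\<omega> < 2"
  shows "\<exists>Xs. A ** Xs + Xs ** B = C \<and> (\<forall>Z. A ** Z + Z ** B = C \<longrightarrow> Z = Xs) \<and>
           (\<forall>X0. (\<exists>!p. fst p 0 = X0 \<and> sylvester_iteration A B C \<alpha> \<omega> (fst p) (snd p)) \<and>
                 (\<forall>X Y. X 0 = X0 \<and> sylvester_iteration A B C \<alpha> \<omega> X Y \<longrightarrow> X \<longlonglongrightarrow> Xs))"
proof -
  note f = linear_matrix_mult_left[of A] pos_def_mult_left_strictly_positive[OF assms(1)]
  note g = linear_matrix_mult_right[of B] pos_semidef_mult_right_nonneg[OF assms(2)]
  have "bij (\<lambda>Y. A ** Y + Y ** B)"
    by (intro strictly_positive_imp_bij linear_compose_add f(1) g(1))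
      (simp add: inner_add_right add_pos_nonneg f(2) g(2))
  then have "\<exists>!Xs. A ** Xs + Xs ** B = C"
    by (simp add: bij_iff)
  then obtain Xs where Xs: "A ** Xs + Xs ** B = C" and uniq: "\<forall>Z. A ** Z + Z ** B = C \<longrightarrow> Z = Xs"
    by (metis (no_types))
  have f0: "0 \<le> inner Y (A ** Y)" for Y :: "complex^'n^'n"
    using f(2)[of Y] by (cases "Y = 0") auto
  have run: "\<exists>!p. fst p 0 = X0 \<and> sylvester_iteration A B C \<alpha> \<omega> (fst p) (snd p)" for X0
    unfolding sylvester_iteration_alt
    by (rule implicit_two_step_recursion_unique
        [OF bij_shifted_nonneg[OF f(1) f0 assms(4)] bij_shifted_nonneg[OF g assms(4)]])
  have conv: "X \<longlonglongrightarrow> Xs" if "sylvester_iteration A B C \<alpha> \<omega> X Y" for X Y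
  proof -
    have it: "\<alpha> *\<^sub>R Y k + A ** Y k = \<alpha> *\<^sub>R X k - X k ** B + C"
      "\<alpha> *\<^sub>R X (Suc k) + X (Suc k) ** B =
        X k ** B - ((1 - \<omega>) * \<alpha>) *\<^sub>R X k + ((2 - \<omega>) * \<alpha>) *\<^sub>R Y k" for k
      using that unfolding sylvester_iteration_alt by auto
    have "(\<lambda>k. X k - Xs) \<longlonglongrightarrow> 0"
    proof (rule two_step_error_tendsto_0[OF f g(2) assms(4-6)])
      show "\<alpha> *\<^sub>R (Y k - Xs) + A ** (Y k - Xs) = \<alpha> *\<^sub>R (X k - Xs) - (X k - Xs) ** B" for k
        using it(1)[of k] unfolding Xs[symmetric]
        by (simp add: matrix_mult_diff_left matrix_mult_diff_right algebra_simps)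
      show "\<alpha> *\<^sub>R (X (Suc k) - Xs) + (X (Suc k) - Xs) ** B =
        (X k - Xs) ** B - ((1 - \<omega>) * \<alpha>) *\<^sub>R (X k - Xs) + ((2 - \<omega>) * \<alpha>) *\<^sub>R (Y k - Xs)" for k
      proof -
        have "((2 - \<omega>) * \<alpha>) *\<^sub>R Xs = \<alpha> *\<^sub>R Xs + ((1 - \<omega>) * \<alpha>) *\<^sub>R Xs"
          unfolding scaleR_add_left[symmetric] by (simp add: algebra_simps)
        then show ?thesis
          using it(2)[of k] by (simp only: matrix_mult_diff_right scaleR_diff_right)
            (simp add: algebra_simps)
      qed
    qed
    then show ?thesis by (simp add: LIM_zero_iff)
  qed
  show ?thesis
  proof (intro exI[of _ Xs] conjI Xs uniq allI run impI)
    fix X0 X Y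
    assume "X 0 = X0 \<and> sylvester_iteration A B C \<alpha> \<omega> X Y"
    then show "X \<longlonglongrightarrow> Xs" by (elim conjE conv)
  qed
qed

end
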